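(* Let $n,d\in\mathbb Z$ with $d\ge0$ and $n\ge3000(d+1)^2$, and define $$\Lambda_d=\left\{\lambda\in\mathbb Z_{\ge0}^6:\ \lambda_{\min}=0,\quad 6d<\operatorname{wt}(\lambda)\le6(d+1)\right\}.$$ The map $\lambda\longmapsto nQ_0+h_\lambda$ induces a bijection between the $S_4$-orbits of $\Lambda_d$ and the integral equivalence classes of positive definite integral ternary quadratic forms $Q$ satisfying $$\min(Q)=n\quad\text{and}\quad 2(n+d)^3<\operatorname{disc}(Q)<2(n+d+1)^3.$$
   Context: An integral ternary quadratic form is $Q=aX^2+bY^2+cZ^2+rYZ+sXZ+tXY$ with $a,b,c,r,s,t\in\mathbb Z$. Its discriminant is $\operatorname{disc}(Q)=4\det(G_Q)=4abc+rst-ar^2-bs^2-ct^2$, where $G_Q$ is the symmetric matrix with $Q(\vec x)=\vec x^{\,T}G_Q\vec x$. For positive definite $Q$, $\min(Q)=\min_{\vec x\in\mathbb Z^3\setminus\{0\}}Q(\vec x)$. Two forms $Q,Q'$ are integrally equivalent if $Q(\vec x)=Q'(U\vec x)$ for some $U\in\operatorname{GL}_3(\mathbb Z)$. Let $Q_0=X^2+Y^2+Z^2+YZ+XZ+XY$. Its minimal vectors, up to sign, are $\vec v_1=(1,0,0)$, $\vec v_2=(0,1,0)$, $\vec v_3=(0,0,1)$, $\vec v_4=(1,-1,0)$, $\vec v_5=(1,0,-1)$, $\vec v_6=(0,1,-1)$. For $\lambda=(\lambda_1,\dots,\lambda_6)\in\mathbb Z^6$, $h_\lambda$ is the unique integral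 ternary quadratic form with $h_\lambda(\vec v_i)=\lambda_i$ for all $i$; explicitly $$h_\lambda=\lambda_1X^2+\lambda_2Y^2+\lambda_3Z^2+(\lambda_2+\lambda_3-\lambda_6)YZ+(\lambda_1+\lambda_3-\lambda_5)XZ+(\lambda_1+\lambda_2-\lambda_4)XY.$$ Write $\operatorname{wt}(\lambda)=\sum_i\lambda_i$ and $\lambda_{\min}=\min_i\lambda_i$. The $S_4$-action on $\mathbb Z^6$: $Q_0$ is (up to scaling by $1/2$) the form of the $A_3$ root lattice, whose minimal vectors up to sign are the $\pm(\vec e_a-\vec e_b)$ for unordered pairs $\{a,b\}\subset\{1,2,3,4\}$. Identify the six coordinates of $\lambda$ with these pairs, via the basis $\vec v_1\leftrightarrow \vec e_1-\vec e_4$, $\vec v_2\leftrightarrow \vec e_2-\vec e_4$, $\vec v_3\leftrightarrow \vec e_3-\vec e_4$; that is, indices $1,2,3,4,5,6$ correspond to $\{1,4\},\{2,4\},\{3,4\},\{1,2\},\{1,3\},\{2,3\}$ respectively. Then $\pi\in S_4$ acts by $(\pi\cdot\lambda)_{\{\pi(a),\pi(b)\}}=\lambda_{\{a,b\}}$. (This is the action induced by $\operatorname{Aut}(Q_0)/\{\pm1\}\cong S_4$ permuting the pairs $\{\pm\vec v_i\}$.) *)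

theory Defs
  imports
    "HOL-Analysis.Analysis"
    "HOL-Algebra.Group_Action"
    "HOL-Algebra.Sym_Groups"
begin

text \<open>\<open>QForm a b c r s t\<close> is \<open>a X^2 + b Y^2 + c Z^2 + r Y Z + s X Z + t X Y\<close>.\<close>

datatype qform =
  QForm (cXX: int) (cYY: int) (cZZ: int) (cYZ: int) (cXZ: int) (cXY: int)

text \<open>Evaluation is polymorphic: it is used at integer vectors (values represented, equivalence)
  and at real vectors (positive definiteness).\<close>

definition qeval :: "qform \<Rightarrow> 'a::comm_ring_1 ^ 3 \<Rightarrow> 'a" where
  "qeval Q x =
     of_int (cXX Q) * (x $ 1)\<^sup>2 + of_int (cYY Q) * (x $ 2)\<^sup>2 + of_int (cZZ Q) * (x $ 3)\<^sup>2
   + of_int (cYZ Q) * (x $ 2 * x $ 3) + of_int (cXZ Q) * (x $ 1 * x $ 3)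
   + of_int (cXY Q) * (x $ 1 * x $ 2)"

instantiation qform :: plus
begin
definition plus_qform :: "qform \<Rightarrow> qform \<Rightarrow> qform" where
  "P + Q = QForm (cXX P + cXX Q) (cYY P + cYY Q) (cZZ P + cZZ Q)
                 (cYZ P + cYZ Q) (cXZ P + cXZ Q) (cXY P + cXY Q)"
instance ..
end

definition qscale :: "int \<Rightarrow> qform \<Rightarrow> qform" where
  "qscale n Q = QForm (n * cXX Q) (n * cYY Q) (n * cZZ Q) (n * cYZ Q) (n * cXZ Q) (n * cXY Q)"

lemma qeval_plus: "qeval (P + Q) x = qeval P x + qeval Q x"
  by (simp add: qeval_def plus_qform_def algebra_simps)

lemma qeval_qscale: "qeval (qscale n Q) x = of_int n * qeval Q x"
  by (simp add: qeval_def qscale_def algebra_simps)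

definition gram :: "qform \<Rightarrow> real ^ 3 ^ 3" where
  "gram Q = vector [vector [cXX Q, cXY Q / 2, cXZ Q / 2],
                    vector [cXY Q / 2, cYY Q, cYZ Q / 2],
                    vector [cXZ Q / 2, cYZ Q / 2, cZZ Q]]"

lemma qeval_gram: "qeval Q x = x \<bullet> (gram Q *v x)"
  by (simp add: qeval_def gram_def matrix_vector_mult_def inner_vec_def sum_3 vector_3
      power2_eq_square field_simps)

text \<open>The discriminant is \<open>4 det G\<close>, which is an integer; it is defined by its integral
  expression, and \<open>disc_gram\<close> identifies it with \<open>4 det G\<close>.\<close>

definition disc :: "qform \<Rightarrow> int" where
  "disc Q = 4 * cXX Q * cYY Q * cZZ Q + cYZ Q * cXZ Q * cXY Q
          - cXX Q * (cYZ Q)\<^sup>2 - cYY Q * (cXZ Q)\<^sup>2 - cZZ Q * (cXY Q)\<^sup>2"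

lemma disc_gram: "real_of_int (disc Q) = 4 * det (gram Q)"
  by (simp add: disc_def gram_def det_3 vector_3 power2_eq_square field_simps)

definition pos_def :: "qform \<Rightarrow> bool" where
  "pos_def Q \<longleftrightarrow> (\<forall>x :: real ^ 3. x \<noteq> 0 \<longrightarrow> qeval Q x > 0)"

text \<open>Only meaningful when the minimum exists, in particular for positive definite forms.\<close>

definition qmin :: "qform \<Rightarrow> int" where
  "qmin Q = (LEAST m. \<exists>x :: int ^ 3. x \<noteq> 0 \<and> qeval Q x = m)"

text \<open>Invertibility is over the integers, so \<open>U\<close> ranges over \<open>GL_3(Z)\<close>.\<close>

definition qequiv :: "qform rel" where
  "qequiv = {(Q, Q'). \<exists>U :: int ^ 3 ^ 3. invertible U \<and> (\<forall>x. qeval Q x = qeval Q' (U *v x))}"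

lemma equiv_qequiv: "equiv UNIV qequiv"
proof (rule equivI)
  show "qequiv \<subseteq> UNIV \<times> UNIV" by simp
  show "refl qequiv"
  proof (rule refl_onI)
    fix Q show "(Q, Q) \<in> qequiv"
      unfolding qequiv_def by (auto intro!: exI[of _ "mat 1"] simp: invertible_def)
  qed
  show "sym qequiv"
  proof (rule symI)
    fix P Q assume "(P, Q) \<in> qequiv"
    then obtain U V :: "int ^ 3 ^ 3" where "U ** V = mat 1" "V ** U = mat 1"
      and *: "\<And>x. qeval P x = qeval Q (U *v x)"
      by (auto simp: qequiv_def invertible_def)
    then have "invertible V" "\<And>x. qeval Q x = qeval P (V *v x)"
      by (auto simp: invertible_def matrix_vector_mul_assoc)
    then show "(Q, P) \<in> qequiv" by (auto simp: qequiv_def)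
  qed
  show "trans qequiv"
  proof (rule transI)
    fix P Q R assume "(P, Q) \<in> qequiv" "(Q, R) \<in> qequiv"
    then obtain U V :: "int ^ 3 ^ 3" where "invertible U" "invertible V"
      "\<And>x. qeval P x = qeval Q (U *v x)" "\<And>x. qeval Q x = qeval R (V *v x)"
      by (auto simp: qequiv_def)
    then have "invertible (V ** U)" "\<And>x. qeval P x = qeval R ((V ** U) *v x)"
      by (auto simp: invertible_mult matrix_vector_mul_assoc)
    then show "(P, R) \<in> qequiv" by (auto simp: qequiv_def)
  qed
qed

definition Q0 :: qform where
  "Q0 = QForm 1 1 1 1 1 1"

definition h :: "int ^ 6 \<Rightarrow> qform" where
  "h l = QForm (l $ 1) (l $ 2) (l $ 3)
               (l $ 2 + l $ 3 - l $ 6) (l $ 1 + l $ 3 - l $ 5) (l $ 1 + l $ 2 - l $ 4)"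

definition minvec :: "6 \<Rightarrow> int ^ 3" where
  "minvec i = (if i = 1 then vector [1, 0, 0]
          else if i = 2 then vector [0, 1, 0]
          else if i = 3 then vector [0, 0, 1]
          else if i = 4 then vector [1, -1, 0]
          else if i = 5 then vector [1, 0, -1]
          else vector [0, 1, -1])"

lemma UNIV_6: "(UNIV :: 6 set) = {1, 2, 3, 4, 5, 6}"
proof -
  have "card {1, 2, 3, 4, 5, 6 :: 6} = CARD(6)" by simp
  then show ?thesis by (metis card_subset_eq finite subset_UNIV)
qed

lemma forall_6: "(\<forall>i :: 6. P i) \<longleftrightarrow> P 1 \<and> P 2 \<and> P 3 \<and> P 4 \<and> P 5 \<and> P 6"
  by (metis UNIV_6 UNIV_I insertE singletonD)

lemma h_unique: "(\<forall>i. qeval Q (minvec i) = l $ i) \<longleftrightarrow> Q = h l"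
  by (cases Q) (auto simp: forall_6 qeval_def minvec_def h_def vector_3)

definition wt :: "int ^ 6 \<Rightarrow> int" where
  "wt l = (\<Sum>i\<in>UNIV. l $ i)"

definition lmin :: "int ^ 6 \<Rightarrow> int" where
  "lmin l = (MIN i. l $ i)"

text \<open>The bijection between the six coordinates and the two-element subsets of \<open>{1, 2, 3, 4}\<close>.\<close>

definition edge :: "6 \<Rightarrow> nat set" where
  "edge i = (if i = 1 then {1, 4}
        else if i = 2 then {2, 4}
        else if i = 3 then {3, 4}
        else if i = 4 then {1, 2}
        else if i = 5 then {1, 3}
        else {2, 3})"

text \<open>The coordinate of \<open>act p l\<close> at \<open>p(e)\<close> is the coordinate of \<open>l\<close> at \<open>e\<close>
  (see \<open>act_nth\<close>); for a permutation \<open>p\<close> of \<open>{1, 2, 3, 4}\<close> the index selected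
  below exists and is unique.\<close>

definition act :: "(nat \<Rightarrow> nat) \<Rightarrow> int ^ 6 \<Rightarrow> int ^ 6" where
  "act p l = (\<chi> j. l $ (THE i. p ` edge i = edge j))"

lemma bij_betw_edge: "bij_betw edge UNIV {e. e \<subseteq> {1..4} \<and> card e = 2}"
proof (rule bij_betw_imageI)
  have "\<forall>i j. edge i = edge j \<longrightarrow> i = j"
    unfolding forall_6 by (simp add: edge_def doubleton_eq_iff)
  then show "inj edge" by (auto simp: inj_def)
  have four: "{1..4} = {1, 2, 3, 4 :: nat}" by auto
  show "range edge = {e. e \<subseteq> {1..4} \<and> card e = 2}"
  proof
    show "range edge \<subseteq> {e. e \<subseteq> {1..4} \<and> card e = 2}"
      by (auto simp: edge_def)
    show "{e. e \<subseteq> {1..4} \<and> card e = 2} \<subseteq> range edge"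
    proof
      fix e assume "e \<in> {e. e \<subseteq> {1..4 :: nat} \<and> card e = 2}"
      then obtain a b where "e = {a, b}" "a \<noteq> b" "a \<in> {1, 2, 3, 4}" "b \<in> {1, 2, 3, 4}"
        unfolding four by (auto simp: card_2_iff)
      then show "e \<in> range edge"
        unfolding UNIV_6 by (auto simp: edge_def doubleton_eq_iff)
    qed
  qed
qed

lemma act_nth:
  assumes p: "p permutes {1..4}" and e: "p ` edge i = edge j"
  shows "act p l $ j = l $ i"
proof -
  have "(THE k. p ` edge k = edge j) = i"
  proof (rule the_equality, rule e)
    fix k assume "p ` edge k = edge j"
    with e have "edge k = edge i"
      using permutes_inj[OF p] by (metis inj_image_eq_iff)
    then show "k = i"
      using bij_betw_edge by (simp add: bij_betw_def inj_eq)
  qed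
  then show ?thesis by (simp add: act_def)
qed

lemma ex_edge:
  assumes p: "p permutes {1..4}"
  shows "\<exists>i. p ` edge i = edge j"
proof -
  let ?e = "inv_into UNIV p ` edge j"
  have q: "inv_into UNIV p permutes {1..4}" using p by (rule permutes_inv)
  have "edge j \<in> {e. e \<subseteq> {1..4} \<and> card e = 2}"
    using bij_betw_edge by (auto simp: bij_betw_def)
  then have "?e \<subseteq> {1..4}" "card ?e = 2"
    using permutes_image[OF q] image_mono[of "edge j" "{1..4}" "inv_into UNIV p"]
      card_image[OF permutes_inj_on[OF q]] by auto
  then have "?e \<in> range edge"
    using bij_betw_edge by (simp add: bij_betw_def)
  then obtain i where "?e = edge i" by auto
  then have "p ` edge i = p ` inv_into UNIV p ` edge j" by simp
  also have "\<dots> = edge j" using p by (simp add: image_comp permutes_inv_o)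
  finally show ?thesis by blast
qed

lemma act_compose:
  assumes p: "p permutes {1..4}" and q: "q permutes {1..4}"
  shows "act (p \<circ> q) l = act p (act q l)"
proof (rule vec_eq_iff[THEN iffD2], rule allI)
  fix k
  obtain j where j: "p ` edge j = edge k" using ex_edge[OF p] by blast
  obtain i where i: "q ` edge i = edge j" using ex_edge[OF q] by blast
  have "(p \<circ> q) ` edge i = edge k" using i j by (metis image_comp)
  then show "act (p \<circ> q) l $ k = act p (act q l) $ k"
    using act_nth[OF permutes_compose[OF q p]] act_nth[OF p j] act_nth[OF q i] by simp
qed

lemma act_id: "act id l = l"
  by (simp add: vec_eq_iff act_nth permutes_id)

lemma group_action_act: "group_action (sym_group 4) UNIV act"
proof -
  have bij: "act p \<in> carrier (BijGroup UNIV)" if p: "p permutes {1..4}" for p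
  proof -
    have "act p \<circ> act (inv_into UNIV p) = id" "act (inv_into UNIV p) \<circ> act p = id"
      using p permutes_inv[OF p]
      by (auto simp: fun_eq_iff act_compose[symmetric] permutes_inv_o act_id)
    then have "bij (act p)" by (metis o_bij)
    then show ?thesis by (simp add: BijGroup_def Bij_def)
  qed
  have "act \<in> hom (sym_group 4) (BijGroup UNIV)"
  proof (rule homI)
    fix p assume "p \<in> carrier (sym_group 4)"
    then show "act p \<in> carrier (BijGroup UNIV)" using bij by (simp add: sym_group_def)
  next
    fix p q assume "p \<in> carrier (sym_group 4)" "q \<in> carrier (sym_group 4)"
    then show "act (p \<otimes>\<^bsub>sym_group 4\<^esub> q) = act p \<otimes>\<^bsub>BijGroup UNIV\<^esub> act q"
      using bij[of p] bij[of q]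
      by (auto simp: sym_group_def BijGroup_def compose_def fun_eq_iff act_compose)
  qed
  then show ?thesis
    by (simp add: group_action_def group_hom_def group_hom_axioms_def
        sym_group_is_group group_BijGroup)
qed

definition Lambda :: "int \<Rightarrow> (int ^ 6) set" where
  "Lambda d = {l. (\<forall>i. l $ i \<ge> 0) \<and> lmin l = 0 \<and> 6 * d < wt l \<and> wt l \<le> 6 * (d + 1)}"

definition Forms :: "int \<Rightarrow> int \<Rightarrow> qform set" where
  "Forms n d = {Q. pos_def Q \<and> qmin Q = n \<and>
     2 * (n + d) ^ 3 < disc Q \<and> disc Q < 2 * (n + d + 1) ^ 3}"

end

theory Submission
  imports Defs
begin

text \<open>A ternary form is determined by its values \<open>x\<^sub>i = Q(v\<^sub>i)\<close> at the six roots (minimal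
  vectors of \<open>Q\<^sub>0\<close> up to sign), so every form is \<open>h x\<close> for a unique \<open>x\<close>, and
  \<open>n Q\<^sub>0 + h\<^sub>\<lambda>\<close> is the form with \<open>x = n + \<lambda>\<close>. Let \<open>D = disc (h x)\<close>, a cubic polynomial in \<open>x\<close>, let
  \<open>p\<^sub>i = \<partial>D/\<partial>x\<^sub>i\<close>, \<open>E = \<Sum>x\<^sub>i\<close> and \<open>F = \<Sum>p\<^sub>i\<close>. If \<open>\<mu>\<^sub>1, \<mu>\<^sub>2, \<mu>\<^sub>3\<close> are the eigenvalues of \<open>Q\<close>
  relative to \<open>Q\<^sub>0\<close>, then \<open>E\<close>, \<open>F\<close>, \<open>D\<close> are twice their elementary symmetric functions, and
  Newton's inequalities say \<open>E\<^sup>2 \<ge> 6F\<close> and \<open>F\<^sup>2 \<ge> 3ED\<close>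
  (\<open>selling_le_wt_square\<close>, \<open>wt_disc_le_selling_square\<close>).

  Surjectivity. The \<open>p\<^sub>i\<close> are the Selling parameters of the adjoint form, and minimizing \<open>F\<close> over the
  equivalence class makes all of them nonnegative (\<open>selling_reduction\<close>). If moreover \<open>min Q = n\<close>,
  then \<open>x\<^sub>i \<ge> n\<close>, and Euler's identity gives \<open>3D = \<Sum>p\<^sub>i x\<^sub>i \<ge> nF\<close>; with \<open>F\<^sup>2 \<ge> 3ED\<close> this yields
  \<open>n\<^sup>2 E \<le> 3D\<close> (\<open>disc_ge_of_reduced\<close>). So for \<open>Q = n Q\<^sub>0 + h\<^sub>\<lambda>\<close> the upper bound on \<open>D\<close> forces
  \<open>wt \<lambda> \<le> 18(d+1)\<close>. In this range the expansion \<open>D = 2n\<^sup>3 + wt(\<lambda>) n\<^sup>2 + O(wt(\<lambda>)\<^sup>2 n)\<close> is sharp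
  enough to give \<open>wt \<lambda> \<le> 6(d+1)\<close>, while \<open>108 D \<le> E\<^sup>3\<close>, the inequality of the arithmetic and
  geometric means, gives \<open>wt \<lambda> > 6d\<close>. The same two estimates show conversely that every
  \<open>\<lambda> \<in> \<Lambda>\<^sub>d\<close> gives a form with discriminant in the required range (\<open>disc_bounds\<close>).

  Injectivity and minimum. For \<open>\<lambda> \<ge> 0\<close> one has \<open>h\<^sub>\<lambda> \<ge> - wt(\<lambda>) Q\<^sub>0\<close>, so \<open>Q \<ge> (n - wt \<lambda>) Q\<^sub>0\<close>.
  Since \<open>n\<close> is much larger than \<open>wt \<lambda>\<close>, the form is positive definite and all its nonzero vectors of
  value at most \<open>n + wt \<lambda>\<close> are roots up to sign (\<open>short_vector\<close>). Hence the minimum is \<open>n + \<lambda>\<^sub>m\<^sub>i\<^sub>n\<close>, and an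
  equivalence between two such forms permutes the roots. A linear map that permutes the roots of
  \<open>A\<^sub>3\<close> is, up to sign, a permutation of the four points whose differences they are
  (\<open>isometry_permutes\<close>), so the two \<open>\<lambda>\<close> lie in one \<open>S\<^sub>4\<close>-orbit.\<close>

section \<open>Unimodular substitutions\<close>

definition pullback :: "qform \<Rightarrow> int ^ 3 ^ 3 \<Rightarrow> qform" where
  "pullback Q U = (let u = column 1 U; v = column 2 U; w = column 3 U in
     QForm (qeval Q u) (qeval Q v) (qeval Q w)
       (qeval Q (v + w) - qeval Q v - qeval Q w)
       (qeval Q (u + w) - qeval Q u - qeval Q w)
       (qeval Q (u + v) - qeval Q u - qeval Q v))"

lemma qeval_pullback: "qeval (pullback Q U) x = qeval Q (U *v x)"
  by (simp add: pullback_def Let_def qeval_def column_def matrix_vector_mult_def sum_3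
      power2_eq_square algebra_simps)

lemma pullback_qequiv:
  assumes "U ** V = mat 1" "V ** U = mat 1"
  shows "(pullback Q U, Q) \<in> qequiv"
  using assms by (auto simp: qequiv_def invertible_def qeval_pullback)

lemma left_invertible_nonzero:
  fixes U V :: "int ^ 3 ^ 3"
  assumes "V ** U = mat 1" "x \<noteq> 0"
  shows "U *v x \<noteq> 0"
proof
  assume "U *v x = 0"
  then have "V *v (U *v x) = 0" by simp
  then show False using assms by (simp add: matrix_vector_mul_assoc)
qed

lemma qform_eqI:
  fixes P Q :: qform
  assumes "\<And>i. qeval P (minvec i) = qeval Q (minvec i)"
  shows "P = Q"
  using h_unique[of P "\<chi> i. qeval Q (minvec i)"] h_unique[of Q "\<chi> i. qeval Q (minvec i)"] assms
  by simp

lemma qform_eq_h: "Q = h (\<chi> i. qeval Q (minvec i))"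
  using h_unique[of Q "\<chi> i. qeval Q (minvec i)"] by simp

lemma qeval_h_minvec: "qeval (h l) (minvec i) = l $ i"
  using h_unique[of "h l" l] by simp

lemma qeval_uminus: "qeval Q (- x) = qeval Q x"
  by (simp add: qeval_def)

lemma qeval_zero: "qeval Q 0 = 0"
  by (simp add: qeval_def)

lemma sum_6: "(\<Sum>i\<in>UNIV. g i) = g (1::6) + g 2 + g 3 + g 4 + g 5 + (g 6 :: int)"
proof -
  have "(\<Sum>i\<in>{1, 2, 3, 4, 5, 6 :: 6}. g i) = g 1 + g 2 + g 3 + g 4 + g 5 + g 6"
    by simp
  then show ?thesis unfolding UNIV_6 .
qed

section \<open>The discriminant and its gradient\<close>

text \<open>The adjugate of twice the Gram matrix of \<open>Q\<close> is \<open>\<Sum>\<^sub>i p\<^sub>i v\<^sub>i v\<^sub>i\<^sup>T\<close> for unique \<open>p\<^sub>i\<close>, the Selling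
  parameters of the adjoint form. By duality \<open>p\<^sub>i\<close> is also the partial derivative of
  \<open>disc (h x)\<close> with respect to \<open>x\<^sub>i\<close>.\<close>

definition selling :: "qform \<Rightarrow> int ^ 6" where
  "selling Q = (let a = cXX Q; b = cYY Q; c = cZZ Q; r = cYZ Q; s = cXZ Q; t = cXY Q;
       p4 = 2 * c * t - r * s; p5 = 2 * b * s - r * t; p6 = 2 * a * r - s * t in
     \<chi> i. if i = 1 then 4 * b * c - r\<^sup>2 - p4 - p5
        else if i = 2 then 4 * a * c - s\<^sup>2 - p4 - p6
        else if i = 3 then 4 * a * b - t\<^sup>2 - p5 - p6
        else if i = 4 then p4 else if i = 5 then p5 else p6)"

lemma selling_nth:
  "selling (QForm a b c r s t) $ 1 = 4 * b * c - r\<^sup>2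
     - selling (QForm a b c r s t) $ 4 - selling (QForm a b c r s t) $ 5"
  "selling (QForm a b c r s t) $ 2 = 4 * a * c - s\<^sup>2
     - selling (QForm a b c r s t) $ 4 - selling (QForm a b c r s t) $ 6"
  "selling (QForm a b c r s t) $ 3 = 4 * a * b - t\<^sup>2
     - selling (QForm a b c r s t) $ 5 - selling (QForm a b c r s t) $ 6"
  "selling (QForm a b c r s t) $ 4 = 2 * c * t - r * s"
  "selling (QForm a b c r s t) $ 5 = 2 * b * s - r * t"
  "selling (QForm a b c r s t) $ 6 = 2 * a * r - s * t"
  by (simp_all add: selling_def Let_def)

text \<open>Euler's identity for the cubic \<open>disc (h x)\<close>; the two lemmas after it are the Taylor expansions of
  this cubic and of its derivative in the direction of \<open>Q\<^sub>0\<close>.\<close>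

lemma disc_euler: "3 * disc (h x) = (\<Sum>i\<in>UNIV. selling (h x) $ i * x $ i)"
  unfolding sum_6 by (simp add: disc_def selling_def h_def Let_def power2_eq_square algebra_simps)

lemma disc_shift:
  "disc (h (\<chi> i. n + l $ i)) = 2 * n ^ 3 + wt l * n\<^sup>2 + wt (selling (h l)) * n + disc (h l)"
  unfolding wt_def sum_6 by (simp add: selling_def h_def disc_def Let_def power2_eq_square power3_eq_cube
      algebra_simps)

lemma selling_shift:
  "wt (selling (h (\<chi> i. n + l $ i))) = 6 * n\<^sup>2 + 2 * n * wt l + wt (selling (h l))"
  unfolding wt_def sum_6 by (simp add: selling_def h_def disc_def Let_def power2_eq_square power3_eq_cube
      algebra_simps)

text \<open>The coordinates are permuted by \<open>S\<^sub>4\<close>, and modulo constant vectors \<open>\<rat>\<^sup>6\<close> is the sum of two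
  irreducible representations: the differences of opposite edges and the differences between
  sums of opposite edges. So each Newton inequality amounts to a combination of the two square sums
  below, with positive coefficients; the ones chosen here are those that occur for the second.\<close>

definition spread :: "int ^ 6 \<Rightarrow> int" where
  "spread y = 6 * ((y $ 1 - y $ 6)\<^sup>2 + (y $ 2 - y $ 5)\<^sup>2 + (y $ 3 - y $ 4)\<^sup>2)
     + ((y $ 1 + y $ 6 - y $ 2 - y $ 5)\<^sup>2 + (y $ 1 + y $ 6 - y $ 3 - y $ 4)\<^sup>2
        + (y $ 2 + y $ 5 - y $ 3 - y $ 4)\<^sup>2)"

text \<open>Newton's inequality \<open>e\<^sub>1\<^sup>2 \<ge> 3 e\<^sub>2\<close> as an identity, with the defect a sum of squares.\<close>

lemma wt_square_minus_selling:
  "2 * (wt x)\<^sup>2 - 12 * wt (selling (h x)) = spread x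
     + 3 * ((x $ 1 + x $ 6 - x $ 2 - x $ 5)\<^sup>2 + (x $ 1 + x $ 6 - x $ 3 - x $ 4)\<^sup>2
        + (x $ 2 + x $ 5 - x $ 3 - x $ 4)\<^sup>2)"
  unfolding wt_def sum_6 spread_def
  by (simp add: selling_def h_def disc_def Let_def power2_eq_square power3_eq_cube
      algebra_simps)

text \<open>Newton's inequality \<open>e\<^sub>2\<^sup>2 \<ge> 3 e\<^sub>1 e\<^sub>3\<close>. It is \<open>e\<^sub>1\<^sup>2 \<ge> 3 e\<^sub>2\<close> applied to the adjoint form, whose
  adjoint is a multiple of \<open>Q\<close>, so the defect is a quadratic form in the Selling parameters.\<close>

lemma selling_square_minus_disc:
  "8 * ((wt (selling (h x)))\<^sup>2 - 3 * wt x * disc (h x)) = spread (selling (h x))"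
proof -
  obtain a b c r s t where Q: "h x = QForm a b c r s t" by (cases "h x")
  define A B C R S T where "A = 4 * b * c - r\<^sup>2" and "B = 4 * a * c - s\<^sup>2" and "C = 4 * a * b - t\<^sup>2"
    and "R = s * t - 2 * a * r" and "S = r * t - 2 * b * s" and "T = r * s - 2 * c * t"
  define D where "D = disc (h x)"
  have D: "D = 4 * a * b * c + r * s * t - a * r\<^sup>2 - b * s\<^sup>2 - c * t\<^sup>2"
    by (simp add: D_def Q disc_def)
  have w: "wt x = 3 * (a + b + c) - (r + s + t)"
    using Q unfolding wt_def sum_6 by (simp add: h_def)
  have p: "selling (h x) $ 1 = A + S + T" "selling (h x) $ 2 = B + R + T"
    "selling (h x) $ 3 = C + R + S" "selling (h x) $ 4 = - T" "selling (h x) $ 5 = - S"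
    "selling (h x) $ 6 = - R"
    by (simp_all add: selling_def Q Let_def A_def B_def C_def R_def S_def T_def)
  \<comment> \<open>The adjugate of the adjugate of a \<open>3 \<times> 3\<close> matrix is the determinant times the matrix.\<close>
  have adj: "4 * a * D = B * C - R\<^sup>2" "4 * b * D = A * C - S\<^sup>2" "4 * c * D = A * B - T\<^sup>2"
    "2 * r * D = S * T - A * R" "2 * s * D = R * T - B * S" "2 * t * D = R * S - C * T"
    unfolding D A_def B_def C_def R_def S_def T_def
    by (simp_all add: power2_eq_square algebra_simps)
  have "4 * wt x * D = 3 * (4 * a * D + 4 * b * D + 4 * c * D)
      - 2 * (2 * r * D + 2 * s * D + 2 * t * D)"
    unfolding w by (simp add: algebra_simps)
  then have ED: "4 * wt x * D = 3 * ((B * C - R\<^sup>2) + (A * C - S\<^sup>2) + (A * B - T\<^sup>2))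
      - 2 * ((S * T - A * R) + (R * T - B * S) + (R * S - C * T))"
    by (simp only: adj)
  have F: "wt (selling (h x)) = A + B + C + R + S + T"
    unfolding wt_def sum_6 p by simp
  have "8 * ((wt (selling (h x)))\<^sup>2 - 3 * wt x * D) = 8 * (A + B + C + R + S + T)\<^sup>2
     - 6 * (4 * wt x * D)"
    unfolding F by (simp add: algebra_simps)
  also have "\<dots> = spread (selling (h x))"
    unfolding ED spread_def p by (simp add: power2_eq_square algebra_simps)
  finally show ?thesis by (simp add: D_def)
qed

section \<open>Selling reduction of the adjoint form\<close>

lemma wt_selling: "wt (selling (QForm a b c r s t)) =
   4 * (a * b + a * c + b * c) + r * s + r * t + s * t - r\<^sup>2 - s\<^sup>2 - t\<^sup>2 - 2 * (a * r + b * s + c * t)"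
  unfolding wt_def sum_6 by (simp add: selling_def Let_def algebra_simps)

text \<open>The Cauchy--Schwarz inequality, from nonnegativity on integral vectors only.\<close>

lemma polar_bound:
  fixes u v :: "int ^ 3"
  assumes nonneg: "\<And>x :: int ^ 3. qeval Q x \<ge> 0" and u: "qeval Q u > 0"
  shows "(qeval Q (u + v) - qeval Q u - qeval Q v)\<^sup>2 \<le> 4 * qeval Q u * qeval Q v"
proof -
  let ?A = "qeval Q u" and ?C = "qeval Q v"
  let ?B = "qeval Q (u + v) - ?A - ?C"
  have comb: "qeval Q (k *s u + m *s v) = ?A * k\<^sup>2 + ?B * (k * m) + ?C * m\<^sup>2" for k m :: int
    by (simp add: qeval_def power2_eq_square algebra_simps)
  have "0 \<le> qeval Q ((- ?B) *s u + (2 * ?A) *s v)" by (rule nonneg)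
  also have "\<dots> = ?A * (4 * ?A * ?C - ?B\<^sup>2)"
    unfolding comb by (simp add: power2_eq_square algebra_simps)
  finally show ?thesis using u by (simp add: zero_le_mult_iff)
qed

lemma minvec_nonzero: "minvec i \<noteq> 0"
  by (auto simp: minvec_def vec_eq_iff forall_3 vector_3)

text \<open>Twice the sum of the Selling parameters is the sum of three terms \<open>4 Q(u) Q(v) - B(u,v)\<^sup>2\<close>, one
  for each pair \<open>u\<close>, \<open>v\<close> of opposite (orthogonal) roots.\<close>

lemma wt_selling_nonneg:
  assumes pos: "\<And>x :: int ^ 3. x \<noteq> 0 \<Longrightarrow> qeval Q x > 0"
  shows "wt (selling Q) \<ge> 0"
proof -
  obtain a b c r s t where Q: "Q = QForm a b c r s t" by (cases Q)
  have nonneg: "qeval Q x \<ge> 0" for x :: "int ^ 3"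
    using pos[of x] by (cases "x = 0") (auto simp: qeval_zero)
  note bound = polar_bound[OF nonneg pos[OF minvec_nonzero]]
  have "(s - r)\<^sup>2 \<le> 4 * c * (a + b - t)"
    using bound[of 3 "minvec 4"] by (simp add: Q qeval_def minvec_def vector_3 algebra_simps)
  moreover have "(t - r)\<^sup>2 \<le> 4 * b * (a + c - s)"
    using bound[of 2 "minvec 5"] by (simp add: Q qeval_def minvec_def vector_3 algebra_simps)
  moreover have "(t - s)\<^sup>2 \<le> 4 * a * (b + c - r)"
    using bound[of 1 "minvec 6"] by (simp add: Q qeval_def minvec_def vector_3 algebra_simps)
  ultimately show ?thesis
    unfolding Q wt_selling by (simp add: power2_eq_square algebra_simps)
qed

text \<open>The step of Selling's algorithm. Write the roots as differences \<open>f\<^sub>a - f\<^sub>b\<close> with \<open>f\<^sub>4 = 0\<close>. The root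
  \<open>v\<^sub>i = f\<^sub>a - f\<^sub>b\<close> is exchanged for \<open>f\<^sub>a + f\<^sub>b - f\<^sub>c - f\<^sub>d\<close>, where \<open>{c, d}\<close> is the opposite edge, while
  the other five roots are kept. The columns of \<open>U\<close> below are \<open>f\<^sub>a + f\<^sub>b - f\<^sub>c - f\<^sub>d\<close>,
  \<open>f\<^sub>a - f\<^sub>d\<close> and \<open>f\<^sub>a - f\<^sub>c\<close>; their differences are again vectors of the new system.\<close>

lemma selling_flip:
  "\<exists>Q'. (Q', Q) \<in> qequiv \<and> disc Q' = disc Q \<and> wt (selling Q') = wt (selling Q) + selling Q $ i"
proof -
  let ?P = "\<lambda>i. \<exists>Q'. (Q', Q) \<in> qequiv \<and> disc Q' = disc Q
                  \<and> wt (selling Q') = wt (selling Q) + selling Q $ i"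
  have step: "?P i" if "U ** V = mat 1" "V ** U = mat 1" "disc (pullback Q U) = disc Q"
     "wt (selling (pullback Q U)) = wt (selling Q) + selling Q $ i" for U V i
    using that pullback_qequiv by blast
  obtain a b c r s t where Q: "Q = QForm a b c r s t" by (cases Q)
  note flip_simps = Q matrix_matrix_mult_def vec_eq_iff forall_3 vector_3 sum_3 mat_def
    pullback_def Let_def column_def qeval_def disc_def wt_selling selling_nth power2_eq_square algebra_simps
  have "?P 1"
    by (rule step[where U = "vector [vector [1, 1, 1], vector [-1, 0, -1], vector [-1, -1, 0]]"
          and V = "vector [vector [-1, -1, -1], vector [1, 1, 0], vector [1, 0, 1]]"])
      (simp_all add: flip_simps)
  have "?P 2"
    by (rule step[where U = "vector [vector [-1, 0, -1], vector [1, 1, 1], vector [-1, -1, 0]]"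
          and V = "vector [vector [-1, -1, -1], vector [1, 1, 0], vector [0, 1, 1]]"])
      (simp_all add: flip_simps)
  have "?P 3"
    by (rule step[where U = "vector [vector [-1, 0, -1], vector [-1, -1, 0], vector [1, 1, 1]]"
          and V = "vector [vector [-1, -1, -1], vector [1, 0, 1], vector [0, 1, 1]]"])
      (simp_all add: flip_simps)
  have "?P 4"
    by (rule step[where U = "vector [vector [1, 1, 1], vector [1, 0, 0], vector [-1, 0, -1]]"
          and V = "vector [vector [0, 1, 0], vector [1, 0, 1], vector [0, -1, -1]]"])
      (simp_all add: flip_simps)
  have "?P 5"
    by (rule step[where U = "vector [vector [1, 1, 1], vector [-1, 0, -1], vector [1, 0, 0]]"
          and V = "vector [vector [0, 0, 1], vector [1, 1, 0], vector [0, -1, -1]]"])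
      (simp_all add: flip_simps)
  have "?P 6"
    by (rule step[where U = "vector [vector [-1, 0, -1], vector [1, 1, 1], vector [1, 0, 0]]"
          and V = "vector [vector [0, 0, 1], vector [1, 1, 0], vector [-1, 0, -1]]"])
      (simp_all add: flip_simps)
  from \<open>?P 1\<close> \<open>?P 2\<close> \<open>?P 3\<close> \<open>?P 4\<close> \<open>?P 5\<close> \<open>?P 6\<close> have "\<forall>i. ?P i"
    unfolding forall_6 by blast
  then show ?thesis by blast
qed

text \<open>A form in the class that minimizes the sum of the Selling parameters has no negative one, as a flip
  at a negative one would lower the sum. The minimum exists because the sum is a natural number for
  every form in the class.\<close>

lemma selling_reduction:
  assumes pos: "\<And>x :: int ^ 3. x \<noteq> 0 \<Longrightarrow> qeval Q x > 0"
  obtains Q' where "(Q', Q) \<in> qequiv" "disc Q' = disc Q" "\<And>i. selling Q' $ i \<ge> 0"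
proof -
  let ?P = "\<lambda>Q'. (Q', Q) \<in> qequiv \<and> disc Q' = disc Q"
  have "?P Q" using equiv_qequiv by (simp add: equiv_def refl_on_def)
  from ex_has_least_nat[of ?P, OF this, of "\<lambda>Q'. nat (wt (selling Q'))"]
  obtain Q' where Q': "?P Q'"
    and least: "\<And>R. ?P R \<Longrightarrow> nat (wt (selling Q')) \<le> nat (wt (selling R))" by blast
  have nonneg: "wt (selling R) \<ge> 0" if R: "(R, Q) \<in> qequiv" for R
  proof (rule wt_selling_nonneg)
    fix x :: "int ^ 3" assume "x \<noteq> 0"
    from R obtain U V :: "int ^ 3 ^ 3" where "V ** U = mat 1" "qeval R x = qeval Q (U *v x)"
      by (auto simp: qequiv_def invertible_def)
    moreover from this have "U *v x \<noteq> 0"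
      using \<open>x \<noteq> 0\<close> left_invertible_nonzero by blast
    ultimately show "qeval R x > 0" using pos by simp
  qed
  have "selling Q' $ i \<ge> 0" for i
  proof -
    obtain R where R: "(R, Q') \<in> qequiv" "disc R = disc Q'"
      "wt (selling R) = wt (selling Q') + selling Q' $ i"
      using selling_flip by blast
    have "(R, Q) \<in> qequiv"
      using R(1) Q' equiv_qequiv by (meson equivE transE)
    then have "nat (wt (selling Q')) \<le> nat (wt (selling R))" "wt (selling R) \<ge> 0"
      using least R(2) Q' nonneg by auto
    then show ?thesis using R(3) nonneg[of Q'] Q' by linarith
  qed
  then show thesis using that Q' by blast
qed

section \<open>The roots\<close>

text \<open>This is the norm of the vector \<open>(x\<^sub>1, x\<^sub>2, x\<^sub>3, - x\<^sub>1 - x\<^sub>2 - x\<^sub>3)\<close> of the \<open>A\<^sub>3\<close> lattice.\<close>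

lemma Q0_squares:
  fixes x :: "'a :: comm_ring_1 ^ 3"
  shows "2 * qeval Q0 x = (x $ 1)\<^sup>2 + (x $ 2)\<^sup>2 + (x $ 3)\<^sup>2 + (x $ 1 + x $ 2 + x $ 3)\<^sup>2"
  by (simp add: qeval_def Q0_def power2_eq_square algebra_simps)

text \<open>In the coordinates \<open>y\<^sub>1, \<dots>, y\<^sub>4\<close> with sum zero, the form dual to the edge \<open>{a, b}\<close> is
  \<open>- y\<^sub>a y\<^sub>b\<close>, and \<open>2 (Q\<^sub>0 - y\<^sub>a y\<^sub>b) = (y\<^sub>a - y\<^sub>b)\<^sup>2 + y\<^sub>c\<^sup>2 + y\<^sub>d\<^sup>2\<close>.\<close>

lemma h_lower_bound:
  fixes x :: "'a :: linordered_idom ^ 3"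
  assumes l: "\<And>i. l $ i \<ge> 0"
  shows "qeval (h l) x \<ge> - (of_int (wt l) * qeval Q0 x)"
proof -
  define X Y Z W where "X = x $ 1" and "Y = x $ 2" and "Z = x $ 3" and "W = X + Y + Z"
  have "2 * (qeval (h l) x + of_int (wt l) * qeval Q0 x) =
      of_int (l $ 1) * ((X + W)\<^sup>2 + Y\<^sup>2 + Z\<^sup>2) + of_int (l $ 2) * ((Y + W)\<^sup>2 + X\<^sup>2 + Z\<^sup>2)
    + of_int (l $ 3) * ((Z + W)\<^sup>2 + X\<^sup>2 + Y\<^sup>2) + of_int (l $ 4) * ((X - Y)\<^sup>2 + Z\<^sup>2 + W\<^sup>2)
    + of_int (l $ 5) * ((X - Z)\<^sup>2 + Y\<^sup>2 + W\<^sup>2) + of_int (l $ 6) * ((Y - Z)\<^sup>2 + X\<^sup>2 + W\<^sup>2)"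
    unfolding wt_def sum_6 X_def Y_def Z_def W_def
    by (simp add: qeval_def h_def Q0_def power2_eq_square algebra_simps)
  also have "\<dots> \<ge> 0"
    using l by (intro add_nonneg_nonneg mult_nonneg_nonneg) auto
  finally have "0 \<le> qeval (h l) x + of_int (wt l) * qeval Q0 x"
    by (simp add: zero_le_mult_iff)
  then show ?thesis by (simp add: algebra_simps)
qed

lemma Q0_pos:
  fixes x :: "'a :: linordered_idom ^ 3"
  assumes "x \<noteq> 0"
  shows "qeval Q0 x > 0"
proof -
  have "2 * qeval Q0 x \<noteq> 0" "2 * qeval Q0 x \<ge> 0"
    using assms unfolding Q0_squares
    by (auto simp: vec_eq_iff forall_3 add_nonneg_eq_0_iff)
  then have "2 * qeval Q0 x > 0" by (simp only: less_le) simp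
  then show ?thesis by (simp add: zero_less_mult_iff)
qed

text \<open>The points \<open>f\<^sub>k\<close> whose differences are the roots. They are the vectors
  \<open>e\<^sub>k - e\<^sub>4\<close> in coordinates with respect to the basis \<open>v\<^sub>1, v\<^sub>2, v\<^sub>3\<close>.\<close>

definition pt :: "nat \<Rightarrow> int ^ 3" where
  "pt k = (if k = 1 then vector [1, 0, 0] else if k = 2 then vector [0, 1, 0]
           else if k = 3 then vector [0, 0, 1] else 0)"

lemma pt_nth [simp]:
  "pt k $ 1 = (if k = 1 then 1 else 0)" "pt k $ 2 = (if k = 2 then 1 else 0)"
  "pt k $ 3 = (if k = 3 then 1 else 0)"
  by (simp_all add: pt_def)

lemma four: "{1..4} = {1, 2, 3, 4 :: nat}" by auto

lemma minvec_edge: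
  obtains a b where "a \<in> {1..4}" "b \<in> {1..4}" "a \<noteq> b" "edge i = {a, b}" "minvec i = pt a - pt b"
proof -
  have "\<forall>i. \<exists>a\<in>{1..4}. \<exists>b\<in>{1..4}. a \<noteq> b \<and> edge i = {a, b} \<and> minvec i = pt a - pt b"
    unfolding forall_6 four
    by (auto simp: edge_def minvec_def vec_eq_iff forall_3 vector_3 doubleton_eq_iff)
  then show thesis using that by blast
qed

lemma edge_minvec:
  assumes "edge i = {a, b}"
  shows "minvec i = pt a - pt b \<or> minvec i = - (pt a - pt b)"
proof -
  obtain a' b' where "edge i = {a', b'}" "minvec i = pt a' - pt b'" using minvec_edge by metis
  then show ?thesis using assms by (auto simp: doubleton_eq_iff)
qed

lemma ex_edge_pair:
  assumes "a \<in> {1..4}" "b \<in> {1..4}" "a \<noteq> b"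
  obtains i where "edge i = {a, b}"
proof -
  have "{a, b} \<in> {e. e \<subseteq> {1..4} \<and> card e = 2}" using assms by auto
  then have "{a, b} \<in> range edge" using bij_betw_edge by (simp add: bij_betw_def)
  then show thesis using that by auto
qed

lemma qeval_h_root:
  assumes "edge i = {a, b}"
  shows "qeval (h l) (pt a - pt b) = l $ i"
  using edge_minvec[OF assms] qeval_h_minvec[of l i] qeval_uminus[of "h l" "pt a - pt b"] by auto

lemma Q0_eq_1:
  fixes v :: "int ^ 3"
  assumes "qeval Q0 v = 1"
  obtains a b where "a \<in> {1..4}" "b \<in> {1..4}" "a \<noteq> b" "v = pt a - pt b"
proof -
  define x y z where "x = v $ 1" and "y = v $ 2" and "z = v $ 3"
  have sq: "x\<^sup>2 + y\<^sup>2 + z\<^sup>2 + (x + y + z)\<^sup>2 = 2"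
    using Q0_squares[of v] assms by (simp add: x_def y_def z_def)
  have small: "k \<in> {-1, 0, 1}" if "k\<^sup>2 \<le> 2" for k :: int
  proof -
    have "\<bar>k\<bar> < 2" using that power_mono[of 2 "\<bar>k\<bar>" 2] by (cases "\<bar>k\<bar> < 2") auto
    then show ?thesis by auto
  qed
  have "x\<^sup>2 \<le> 2" "y\<^sup>2 \<le> 2" "z\<^sup>2 \<le> 2"
    using sq zero_le_power2[of x] zero_le_power2[of y] zero_le_power2[of z]
      zero_le_power2[of "x + y + z"] by linarith+
  then have xyz: "x \<in> {-1, 0, 1}" "y \<in> {-1, 0, 1}" "z \<in> {-1, 0, 1}"
    using small by blast+
  have "\<exists>a\<in>{1, 2, 3, 4}. \<exists>b\<in>{1, 2, 3, 4}. a \<noteq> b \<and> v = pt a - pt b"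
    using xyz sq unfolding vec_eq_iff forall_3 x_def[symmetric] y_def[symmetric] z_def[symmetric]
    by (elim insertE emptyE) simp_all
  then show thesis using that unfolding four by blast
qed

text \<open>Two roots whose difference is a root meet at an angle of 60 degrees. As directed edges they
  then either start at the same point or end at the same point.\<close>

lemma Q0_root_diff:
  assumes "a \<in> {1..4}" "b \<in> {1..4}" "a \<noteq> b" "c \<in> {1..4}" "d \<in> {1..4}" "c \<noteq> d"
    and "qeval Q0 ((pt a - pt b) - (pt c - pt d)) = 1"
  shows "(a = c) \<noteq> (b = d)"
  using assms unfolding four
  by (elim insertE emptyE) (simp_all add: qeval_def Q0_def)

section \<open>Permutations of the four points\<close>

text \<open>The linear map that sends \<open>f\<^sub>a - f\<^sub>b\<close> to \<open>f\<^bsub>p a\<^esub> - f\<^bsub>p b\<^esub>\<close> for all \<open>a\<close> and \<open>b\<close>.\<close>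

definition perm_matrix :: "(nat \<Rightarrow> nat) \<Rightarrow> int ^ 3 ^ 3" where
  "perm_matrix p = transpose (vector [pt (p 1) - pt (p 4), pt (p 2) - pt (p 4), pt (p 3) - pt (p 4)])"

lemma perm_matrix_pt:
  assumes "k \<in> {1..4}"
  shows "perm_matrix p *v pt k = pt (p k) - pt (p 4)"
  using assms unfolding four
  by (elim insertE emptyE)
    (simp_all add: perm_matrix_def
      matrix_vector_mult_def transpose_def vec_eq_iff forall_3 sum_3 vector_3)

lemma matrix_eq_pt:
  fixes U V :: "int ^ 3 ^ 3"
  assumes "\<And>k. k \<in> {1..4} \<Longrightarrow> U *v pt k = V *v pt k"
  shows "U = V"
  using assms[of 1] assms[of 2] assms[of 3]
  by (simp add: matrix_vector_mult_def vec_eq_iff forall_3 sum_3 vector_3)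

lemma perm_matrix_diff:
  assumes "a \<in> {1..4}" "b \<in> {1..4}"
  shows "perm_matrix p *v (pt a - pt b) = pt (p a) - pt (p b)"
  using assms by (simp add: perm_matrix_pt matrix_vector_mult_diff_distrib)

lemma perm_matrix_compose:
  assumes q: "q permutes {1..4}"
  shows "perm_matrix p ** perm_matrix q = perm_matrix (p \<circ> q)"
proof (rule matrix_eq_pt)
  fix k :: nat assume "k \<in> {1..4}"
  then have "q k \<in> {1..4}" "q 4 \<in> {1..4}" using permutes_in_image[OF q] by auto
  then show "perm_matrix p ** perm_matrix q *v pt k = perm_matrix (p \<circ> q) *v pt k"
    using \<open>k \<in> {1..4}\<close>
    by (simp add: matrix_vector_mul_assoc[symmetric] perm_matrix_pt perm_matrix_diff)
qed

lemma perm_matrix_id: "perm_matrix id = mat 1"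
proof (rule matrix_eq_pt)
  fix k :: nat assume "k \<in> {1..4}"
  moreover have "pt 4 = 0" by (simp add: vec_eq_iff forall_3)
  ultimately show "perm_matrix id *v pt k = mat 1 *v pt k" by (simp add: perm_matrix_pt)
qed

lemma act_qequiv:
  assumes p: "p permutes {1..4}"
  shows "(h l, h (act p l)) \<in> qequiv"
proof -
  have q: "inv_into UNIV p permutes {1..4}" using p by (rule permutes_inv)
  have "pullback (h (act p l)) (perm_matrix p) = h l"
  proof (rule qform_eqI)
    fix i
    obtain a b where ab: "a \<in> {1..4}" "b \<in> {1..4}" "edge i = {a, b}" "minvec i = pt a - pt b"
      using minvec_edge by metis
    obtain j where j: "edge j = p ` edge i"
    proof -
      have "a \<noteq> b" using ab(3,4) minvec_nonzero[of i] by auto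
      then have "p a \<in> {1..4}" "p b \<in> {1..4}" "p a \<noteq> p b"
        using ab permutes_in_image[OF p] permutes_inj[OF p] by (auto dest: injD)
      then show thesis using that ex_edge_pair ab(3) by (metis image_empty image_insert)
    qed
    have "qeval (pullback (h (act p l)) (perm_matrix p)) (minvec i)
        = qeval (h (act p l)) (pt (p a) - pt (p b))"
      using ab by (simp add: qeval_pullback perm_matrix_diff)
    also have "\<dots> = act p l $ j" using j ab(3) by (intro qeval_h_root) simp
    also have "\<dots> = l $ i" using act_nth[OF p] j by simp
    also have "\<dots> = qeval (h l) (minvec i)" by (simp add: qeval_h_minvec)
    finally show "qeval (pullback (h (act p l)) (perm_matrix p)) (minvec i)
        = qeval (h l) (minvec i)" .
  qed
  moreover have "(pullback (h (act p l)) (perm_matrix p), h (act p l)) \<in> qequiv"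
    using p q by (intro pullback_qequiv[where V = "perm_matrix (inv_into UNIV p)"])
      (simp_all add: perm_matrix_compose permutes_inv_o perm_matrix_id)
  ultimately show ?thesis by simp
qed

lemma permutation_of_four:
  assumes "distinct [a, b, c, d]" "{a, b, c, d} \<subseteq> {1..4}"
  obtains p where "p permutes {1..4 :: nat}" "p 1 = a" "p 2 = b" "p 3 = c" "p 4 = d"
proof -
  define p where "p = id(1 := a, 2 := b, 3 := c, 4 := d)"
  have "inj_on p {1..4}" "p ` {1..4} \<subseteq> {1..4}"
    using assms unfolding four by (auto simp: p_def inj_on_def)
  then have "bij_betw p {1..4} {1..4}"
    by (simp add: bij_betw_def endo_inj_surj)
  then have "p permutes {1..4}"
    by (rule bij_imp_permutes) (auto simp: p_def)
  then show thesis by (rule that) (simp_all add: p_def)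
qed

text \<open>The images of the three roots \<open>f\<^sub>1 - f\<^sub>4\<close>, \<open>f\<^sub>2 - f\<^sub>4\<close>, \<open>f\<^sub>3 - f\<^sub>4\<close> are directed edges that pairwise
  share a head or a tail. A common tail of two of them and a common head of another two would
  contradict each other at the third pair, so all three share a tail, or all three share a head; the
  second case is the first one up to sign.\<close>

lemma isometry_permutes:
  fixes U :: "int ^ 3 ^ 3"
  assumes U: "\<And>i. qeval Q0 (U *v minvec i) = 1"
  obtains p where "p permutes {1..4}"
    "\<And>a b. a \<in> {1..4} \<Longrightarrow> b \<in> {1..4} \<Longrightarrow>
       U *v (pt a - pt b) = pt (p a) - pt (p b) \<or> U *v (pt a - pt b) = - (pt (p a) - pt (p b))"
proof -
  have pt4: "pt 4 = 0" by (simp add: vec_eq_iff forall_3)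
  have root: "qeval Q0 (U *v pt a - U *v pt b) = 1" if ab: "a \<in> {1..4}" "b \<in> {1..4}" "a \<noteq> b" for a b
  proof -
    obtain i where i: "edge i = {a, b}" using ex_edge_pair[OF ab] .
    have diff: "U *v pt a - U *v pt b = U *v (pt a - pt b)"
      by (simp add: matrix_vector_mult_diff_distrib)
    from edge_minvec[OF i] show ?thesis
    proof
      assume "minvec i = pt a - pt b"
      then show ?thesis using U[of i] by (simp only: diff)
    next
      assume neg: "minvec i = - (pt a - pt b)"
      have "U *v minvec i = - (U *v (pt a - pt b))"
        unfolding neg using matrix_vector_mult_diff_distrib[of U 0 "pt a - pt b"] by simp
      then show ?thesis using U[of i] by (simp only: diff qeval_uminus)
    qed
  qed
  obtain a b where ab: "a \<in> {1..4}" "b \<in> {1..4}" "a \<noteq> b" "U *v pt 1 = pt a - pt b"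
    using Q0_eq_1[of "U *v pt 1"] root[of 1 4] pt4 by auto
  obtain c d where cd: "c \<in> {1..4}" "d \<in> {1..4}" "c \<noteq> d" "U *v pt 2 = pt c - pt d"
    using Q0_eq_1[of "U *v pt 2"] root[of 2 4] pt4 by auto
  obtain e g where eg: "e \<in> {1..4}" "g \<in> {1..4}" "e \<noteq> g" "U *v pt 3 = pt e - pt g"
    using Q0_eq_1[of "U *v pt 3"] root[of 3 4] pt4 by auto
  have 12: "(a = c) \<noteq> (b = d)"
    using root[of 1 2] ab cd by (intro Q0_root_diff) auto
  have 13: "(a = e) \<noteq> (b = g)"
    using root[of 1 3] ab eg by (intro Q0_root_diff) auto
  have 23: "(c = e) \<noteq> (d = g)"
    using root[of 2 3] cd eg by (intro Q0_root_diff) auto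
  consider "b = d" "b = g" "a \<noteq> c" "a \<noteq> e" "c \<noteq> e" | "a = c" "a = e" "b \<noteq> d" "b \<noteq> g" "d \<noteq> g"
    using 12 13 23 by auto
  then show thesis
  proof cases
    case 1
    obtain p where p: "p permutes {1..4}" "p 1 = a" "p 2 = c" "p 3 = e" "p 4 = b"
      using permutation_of_four[of a c e b] 1 ab cd eg by auto
    have "U *v pt k = pt (p k) - pt (p 4)" if "k \<in> {1..4}" for k
      using that unfolding four using ab cd eg 1 p pt4 by auto
    then show thesis using that[OF p(1)] by (simp add: matrix_vector_mult_diff_distrib)
  next
    case 2
    obtain p where p: "p permutes {1..4}" "p 1 = b" "p 2 = d" "p 3 = g" "p 4 = a"
      using permutation_of_four[of b d g a] 2 ab cd eg by auto
    have "U *v pt k = - (pt (p k) - pt (p 4))" if "k \<in> {1..4}" for k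
      using that unfolding four using ab cd eg 2 p pt4 by auto
    then show thesis using that[OF p(1)] by (simp add: matrix_vector_mult_diff_distrib)
  qed
qed

section \<open>Inequalities for the discriminant\<close>

lemma spread_nonneg: "spread y \<ge> 0"
  by (simp add: spread_def)

lemma spread_eq_0:
  assumes "spread y = 0"
  shows "y $ i = y $ j"
proof -
  have zero: "A = 0 \<and> B = 0 \<and> C = 0 \<and> D = 0 \<and> E = 0"
    if "6 * (A + B + C) + (D + E + F) = 0" "A \<ge> 0" "B \<ge> 0" "C \<ge> 0" "D \<ge> 0" "E \<ge> 0" "F \<ge> 0"
    for A B C D E F :: int using that by (simp add: add_nonneg_eq_0_iff)
  have "y $ 1 = y $ 6 \<and> y $ 2 = y $ 5 \<and> y $ 3 = y $ 4
      \<and> y $ 1 + y $ 6 - y $ 2 - y $ 5 = 0 \<and> y $ 1 + y $ 6 - y $ 3 - y $ 4 = 0"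
    using zero[OF assms[unfolded spread_def]] by simp
  then have "\<forall>i. y $ i = y $ 1" unfolding forall_6 by auto
  then show ?thesis by metis
qed

lemma selling_le_wt_square: "12 * wt (selling (h x)) + spread x \<le> 2 * (wt x)\<^sup>2"
proof -
  have "0 \<le> 3 * ((x $ 1 + x $ 6 - x $ 2 - x $ 5)\<^sup>2 + (x $ 1 + x $ 6 - x $ 3 - x $ 4)\<^sup>2
        + (x $ 2 + x $ 5 - x $ 3 - x $ 4)\<^sup>2)" by simp
  then show ?thesis using wt_square_minus_selling[of x] by linarith
qed

lemma wt_disc_le_selling_square: "3 * wt x * disc (h x) \<le> (wt (selling (h x)))\<^sup>2"
  using selling_square_minus_disc[of x] spread_nonneg[of "selling (h x)"] by simp

text \<open>The inequality \<open>27 e\<^sub>3 \<le> e\<^sub>1\<^sup>3\<close> of the arithmetic and geometric means, obtained by combining both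
  Newton inequalities: \<open>E\<^sup>4 \<ge> 36 F\<^sup>2 \<ge> 108 E D\<close>. It is strict as soon as \<open>Q\<close> is not a multiple of
  \<open>Q\<^sub>0\<close>, which is what the strict upper bound on the discriminant needs.\<close>

lemma disc_le_cube:
  assumes E: "wt x > 0" and F: "wt (selling (h x)) \<ge> 0"
  shows "108 * disc (h x) \<le> wt x ^ 3"
    and "spread x > 0 \<Longrightarrow> 108 * disc (h x) < wt x ^ 3"
proof -
  let ?E = "wt x" and ?F = "wt (selling (h x))" and ?D = "disc (h x)"
  have "6 * ?F \<le> ?E\<^sup>2" using selling_le_wt_square[of x] spread_nonneg[of x] by simp
  then have "(6 * ?F)\<^sup>2 \<le> (?E\<^sup>2)\<^sup>2" using F by (intro power_mono) auto
  then have "36 * ?F\<^sup>2 \<le> ?E * ?E ^ 3"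
    by (simp add: power2_eq_square power3_eq_cube algebra_simps)
  then have "?E * (108 * ?D) \<le> ?E * ?E ^ 3"
    using wt_disc_le_selling_square[of x] by (simp add: algebra_simps)
  then show "108 * ?D \<le> ?E ^ 3" using E by simp
  assume "spread x > 0"
  then have "6 * ?F < ?E\<^sup>2" using selling_le_wt_square[of x] by simp
  then have "(6 * ?F)\<^sup>2 < (?E\<^sup>2)\<^sup>2" using F by (intro power_strict_mono) auto
  then have "36 * ?F\<^sup>2 < ?E * ?E ^ 3"
    by (simp add: power2_eq_square power3_eq_cube algebra_simps)
  then have "?E * (108 * ?D) < ?E * ?E ^ 3"
    using wt_disc_le_selling_square[of x] by (simp add: algebra_simps)
  then show "108 * ?D < ?E ^ 3" using E by simp
qed

text \<open>Here reduction pays off: nonnegative \<open>p\<^sub>i\<close> turn Euler's identity into \<open>3D \<ge> nF\<close>, so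
  \<open>9 D\<^sup>2 \<ge> n\<^sup>2 F\<^sup>2 \<ge> 3 n\<^sup>2 E D\<close>. As \<open>E \<ge> 6n\<close>, this contains the Hermite bound \<open>D \<ge> 2 n\<^sup>3\<close>, but it
  also controls the sum of the deviations of the \<open>x\<^sub>i\<close> from \<open>n\<close>.\<close>

lemma disc_ge_of_reduced:
  assumes p: "\<And>i. selling (h x) $ i \<ge> 0" and x: "\<And>i. x $ i \<ge> n" and n: "n > 0"
    and D: "disc (h x) > 0"
  shows "n\<^sup>2 * wt x \<le> 3 * disc (h x)"
proof -
  let ?E = "wt x" and ?F = "wt (selling (h x))" and ?D = "disc (h x)"
  have "n * ?F \<le> 3 * ?D"
    unfolding disc_euler wt_def sum_distrib_left
    using p x by (intro sum_mono) (simp add: mult.commute[of n] mult_left_mono)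
  moreover have "?F \<ge> 0" unfolding wt_def using p by (intro sum_nonneg) auto
  ultimately have "(n * ?F)\<^sup>2 \<le> (3 * ?D)\<^sup>2" using n by (intro power_mono) auto
  then have "n\<^sup>2 * ?F\<^sup>2 \<le> 3 * ?D * (3 * ?D)"
    by (simp add: power2_eq_square algebra_simps)
  moreover have "n\<^sup>2 * (3 * ?E * ?D) \<le> n\<^sup>2 * ?F\<^sup>2"
    using wt_disc_le_selling_square by (intro mult_left_mono) auto
  ultimately have "3 * ?D * (n\<^sup>2 * ?E) \<le> 3 * ?D * (3 * ?D)"
    by (simp add: algebra_simps)
  then show ?thesis using D by (simp add: mult.commute)
qed

lemma le_wt:
  assumes "\<And>i. l $ i \<ge> 0"
  shows "l $ i \<le> wt l"
  unfolding wt_def using assms by (intro member_le_sum) auto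

lemma wt_nonneg:
  assumes "\<And>i. l $ i \<ge> 0"
  shows "0 \<le> wt l"
  unfolding wt_def using assms by (intro sum_nonneg) auto

lemma wt_selling_ge:
  assumes l: "\<And>i. l $ i \<ge> 0"
  shows "wt (selling (h l)) \<ge> - (wt l)\<^sup>2"
proof -
  define x1 x2 x3 x4 x5 x6 where "x1 = l $ 1" and "x2 = l $ 2" and "x3 = l $ 3"
    and "x4 = l $ 4" and "x5 = l $ 5" and "x6 = l $ 6"
  note x = this
  have pos: "x1 \<ge> 0" "x2 \<ge> 0" "x3 \<ge> 0" "x4 \<ge> 0" "x5 \<ge> 0" "x6 \<ge> 0"
    using l by (simp_all add: x)
  have "wt (selling (h l)) + (wt l)\<^sup>2 =
     3 * (x1 * x2 + x1 * x3 + x1 * x4 + x1 * x5 + x2 * x3 + x2 * x4 + x2 * x6 + x3 * x5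
        + x3 * x6 + x4 * x5 + x4 * x6 + x5 * x6) + 2 * (x1 * x6 + x2 * x5 + x3 * x4)"
    unfolding h_def wt_selling unfolding wt_def sum_6 x
    by (simp add: power2_eq_square algebra_simps)
  also have "\<dots> \<ge> 0" using pos by (intro add_nonneg_nonneg mult_nonneg_nonneg) auto
  finally show ?thesis by simp
qed

lemma disc_ge:
  assumes l: "\<And>i. l $ i \<ge> 0"
  shows "disc (h l) \<ge> - 4 * wt l ^ 3"
proof -
  define w where "w = wt l"
  obtain a b c r s t where Q: "h l = QForm a b c r s t" by (cases "h l")
  have w: "w = l $ 1 + l $ 2 + l $ 3 + l $ 4 + l $ 5 + l $ 6"
    unfolding w_def wt_def sum_6 ..
  have abc: "0 \<le> a" "a \<le> w" "0 \<le> b" "b \<le> w" "0 \<le> c" "c \<le> w"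
    and rst: "\<bar>r\<bar> \<le> w" "\<bar>s\<bar> \<le> w" "\<bar>t\<bar> \<le> w"
    using Q l[of 1] l[of 2] l[of 3] l[of 4] l[of 5] l[of 6] unfolding w by (auto simp: h_def)
  have sq: "u * v\<^sup>2 \<le> w ^ 3" if "0 \<le> u" "u \<le> w" "\<bar>v\<bar> \<le> w" for u v
  proof -
    have "\<bar>v\<bar>\<^sup>2 \<le> w\<^sup>2" using that by (intro power_mono) auto
    then have "u * v\<^sup>2 \<le> w * w\<^sup>2" using that by (intro mult_mono) auto
    then show ?thesis by (simp add: power2_eq_square power3_eq_cube)
  qed
  have "\<bar>r\<bar> * \<bar>s\<bar> * \<bar>t\<bar> \<le> w * w * w" using rst by (intro mult_mono mult_nonneg_nonneg) auto
  then have "- (w ^ 3) \<le> r * s * t" by (simp add: abs_mult[symmetric] power3_eq_cube abs_le_iff)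
  moreover have "0 \<le> 4 * a * b * c" using abc by simp
  moreover have "a * r\<^sup>2 \<le> w ^ 3" "b * s\<^sup>2 \<le> w ^ 3" "c * t\<^sup>2 \<le> w ^ 3"
    using abc rst by (auto intro!: sq)
  ultimately show ?thesis unfolding Q disc_def w_def[symmetric] by simp
qed

lemma wt_shift: "wt (\<chi> i. n + l $ i) = 6 * n + wt l"
  unfolding wt_def sum_6 by simp

lemma disc_shift_ge:
  assumes l: "\<And>i. l $ i \<ge> 0" and n: "n \<ge> 0"
  shows "disc (h (\<chi> i. n + l $ i)) \<ge> 2 * n ^ 3 + wt l * n\<^sup>2 - (wt l)\<^sup>2 * n - 4 * wt l ^ 3"
proof -
  have "wt (selling (h l)) * n \<ge> - (wt l)\<^sup>2 * n"
    using wt_selling_ge[OF l] n by (intro mult_right_mono) auto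
  then show ?thesis unfolding disc_shift using disc_ge[OF l] by simp
qed

text \<open>The form in which the hypothesis \<open>n \<ge> 3000 k\<^sup>2\<close> enters the estimates of the discriminant: it makes \<open>k\<^sup>2 n\<close> and
  \<open>k\<^sup>3\<close> negligible against \<open>n\<^sup>2\<close>.\<close>

lemma powers_small:
  fixes k n :: int
  assumes k: "k \<ge> 1" and n: "n \<ge> 3000 * k\<^sup>2"
  shows "3000 * (k\<^sup>2 * n) \<le> n\<^sup>2" "3000 * k ^ 3 \<le> k\<^sup>2 * n"
proof -
  have n0: "n \<ge> 0" using n zero_le_power2[of k] by linarith
  then show "3000 * (k\<^sup>2 * n) \<le> n\<^sup>2"
    using mult_right_mono[OF n n0] by (simp add: power2_eq_square algebra_simps)
  have "k \<le> k\<^sup>2" using k by (simp add: power2_eq_square)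
  then have "k\<^sup>2 * (3000 * k) \<le> k\<^sup>2 * n" using n by (intro mult_left_mono) auto
  then show "3000 * k ^ 3 \<le> k\<^sup>2 * n"
    by (simp add: power2_eq_square power3_eq_cube algebra_simps)
qed

text \<open>A bootstrap: \<open>disc_ge_of_reduced\<close> first gives the crude bound \<open>wt l \<le> 18 k\<close>. Then
  \<open>disc_shift_ge\<close> has an error of at most a few hundred times \<open>k\<^sup>2 n\<close>, less than \<open>n\<^sup>2\<close>, which leaves
  no room for \<open>wt l \<ge> 6 k + 1\<close>.\<close>

lemma wt_le_of_reduced:
  assumes p: "\<And>i. selling (h (\<chi> i. n + l $ i)) $ i \<ge> 0" and l: "\<And>i. l $ i \<ge> 0"
    and k: "k \<ge> 1" and n: "n \<ge> 3000 * k\<^sup>2"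
    and D: "0 < disc (h (\<chi> i. n + l $ i))" "disc (h (\<chi> i. n + l $ i)) < 2 * (n + k) ^ 3"
  shows "wt l \<le> 6 * k"
proof (rule ccontr)
  let ?D = "disc (h (\<chi> i. n + l $ i))" and ?w = "wt l"
  note small = powers_small[OF k n]
  have n0: "n > 0" using n one_le_power[OF k, of 2] by linarith
  then have nn: "n\<^sup>2 > 0" by simp
  have cube: "2 * (n + k) ^ 3 = 2 * n ^ 3 + 6 * (k * n\<^sup>2) + 6 * (k\<^sup>2 * n) + 2 * k ^ 3"
    by (simp add: power2_eq_square power3_eq_cube algebra_simps)
  have "n\<^sup>2 * (6 * n + ?w) \<le> 3 * ?D"
    using disc_ge_of_reduced[of "\<chi> i. n + l $ i" n] p l n0 D(1) unfolding wt_shift by simp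
  also have "n\<^sup>2 * (6 * n + ?w) = 6 * n ^ 3 + ?w * n\<^sup>2"
    by (simp add: power2_eq_square power3_eq_cube algebra_simps)
  finally have "?w * n\<^sup>2 < 18 * (k * n\<^sup>2) + n\<^sup>2" using D(2) small nn unfolding cube by linarith
  then have "n\<^sup>2 * ?w < n\<^sup>2 * (18 * k + 1)" by (simp add: algebra_simps)
  then have w: "?w \<le> 18 * k" using nn by (simp add: mult_less_cancel_left)
  have "?w\<^sup>2 \<le> (18 * k)\<^sup>2" using w wt_nonneg[OF l] by (intro power_mono) auto
  then have "?w\<^sup>2 * n \<le> (18 * k)\<^sup>2 * n" using n0 by (intro mult_right_mono) auto
  then have w2: "?w\<^sup>2 * n \<le> 324 * (k\<^sup>2 * n)" by (simp add: power_mult_distrib)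
  have "?w ^ 3 \<le> (18 * k) ^ 3" using w wt_nonneg[OF l] by (intro power_mono) auto
  then have w3: "?w ^ 3 \<le> 5832 * k ^ 3" by (simp add: power_mult_distrib)
  assume "\<not> ?w \<le> 6 * k"
  then have "(6 * k + 1) * n\<^sup>2 \<le> ?w * n\<^sup>2" by (intro mult_right_mono) auto
  then have w1: "6 * (k * n\<^sup>2) + n\<^sup>2 \<le> ?w * n\<^sup>2" by (simp add: algebra_simps)
  show False
    using disc_shift_ge[OF l, of n] n0 D(2) small w1 w2 w3 nn unfolding cube by linarith
qed

lemma wt_gt_of_disc_gt:
  assumes F: "wt (selling (h (\<chi> i. n + l $ i))) \<ge> 0" and l: "\<And>i. l $ i \<ge> 0"
    and n: "n > 0" and D: "2 * (n + d) ^ 3 < disc (h (\<chi> i. n + l $ i))"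
  shows "6 * d < wt l"
proof (rule ccontr)
  assume "\<not> 6 * d < wt l"
  then have "(6 * n + wt l) ^ 3 \<le> (6 * (n + d)) ^ 3"
    using n wt_nonneg[OF l] by (intro power_mono) auto
  also have "\<dots> = 108 * (2 * (n + d) ^ 3)" unfolding power_mult_distrib by simp
  finally show False
    using disc_le_cube(1)[OF _ F] n wt_nonneg[OF l] D unfolding wt_shift by simp
qed

text \<open>The lower bound holds because \<open>wt l \<ge> 6 d + 1\<close> provides a surplus of \<open>n\<^sup>2\<close> over the leading terms
  of \<open>2 (n + d)\<^sup>3\<close>. For the upper bound no estimate would do when \<open>wt l = 6 (d + 1)\<close>, as both
  sides then agree up to order \<open>n\<^sup>2\<close>; the strict inequality of the means settles it, since a
  vanishing entry and a positive weight make \<open>l\<close> nonconstant.\<close>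

lemma disc_bounds:
  assumes l: "\<And>i. l $ i \<ge> 0" and i: "l $ i = 0" and d: "d \<ge> 0" and n: "n \<ge> 3000 * (d + 1)\<^sup>2"
    and w: "6 * d < wt l" "wt l \<le> 6 * (d + 1)"
  shows "2 * (n + d) ^ 3 < disc (h (\<chi> i. n + l $ i))"
    and "disc (h (\<chi> i. n + l $ i)) < 2 * (n + d + 1) ^ 3"
proof -
  let ?x = "\<chi> i. n + l $ i" and ?w = "wt l"
  define k where "k = d + 1"
  have k: "k \<ge> 1" "n \<ge> 3000 * k\<^sup>2" "6 * k - 6 < ?w" "?w \<le> 6 * k"
    using d n w by (auto simp: k_def)
  note small = powers_small[OF k(1,2)]
  have n0: "n > 0" using k(2) one_le_power[OF k(1), of 2] by linarith
  then have nn: "n\<^sup>2 > 0" by simp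
  have "?w\<^sup>2 \<le> (6 * k)\<^sup>2" using k wt_nonneg[OF l] by (intro power_mono) auto
  then have w2: "?w\<^sup>2 \<le> 36 * k\<^sup>2" by (simp add: power_mult_distrib)
  then have w2n: "?w\<^sup>2 * n \<le> 36 * (k\<^sup>2 * n)"
    using n0 mult_right_mono[OF w2, of n] by simp
  have "?w ^ 3 \<le> (6 * k) ^ 3" using k wt_nonneg[OF l] by (intro power_mono) auto
  then have w3: "?w ^ 3 \<le> 216 * k ^ 3" by (simp add: power_mult_distrib)
  have "(6 * d + 1) * n\<^sup>2 \<le> ?w * n\<^sup>2" using w by (intro mult_right_mono) auto
  then have w1: "6 * (d * n\<^sup>2) + n\<^sup>2 \<le> ?w * n\<^sup>2" by (simp add: algebra_simps)
  have "d\<^sup>2 \<le> k\<^sup>2" "d ^ 3 \<le> k ^ 3" using d by (auto simp: k_def intro: power_mono)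
  then have d2: "d\<^sup>2 * n \<le> k\<^sup>2 * n" "d ^ 3 \<le> k ^ 3" using n0 by (auto intro: mult_right_mono)
  have cube: "2 * (n + d) ^ 3 = 2 * n ^ 3 + 6 * (d * n\<^sup>2) + 6 * (d\<^sup>2 * n) + 2 * d ^ 3"
    by (simp add: power2_eq_square power3_eq_cube algebra_simps)
  show "2 * (n + d) ^ 3 < disc (h ?x)"
    using disc_shift_ge[OF l, of n] n0 small w1 w2n w3 nn d2 unfolding cube by linarith
  have "0 \<le> n * ?w" using n0 wt_nonneg[OF l] by simp
  moreover have "k\<^sup>2 \<le> k\<^sup>2 * n" using n0 by (simp add: mult_le_cancel_left1)
  ultimately have F: "wt (selling (h ?x)) \<ge> 0"
    unfolding selling_shift mult.assoc using wt_selling_ge[OF l] w2 small nn by linarith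
  have "spread ?x \<noteq> 0"
  proof
    assume "spread ?x = 0"
    then have "l $ j = 0" for j using spread_eq_0[of ?x j i] i by simp
    then have "wt l = 0" by (simp add: wt_def)
    then show False using w d by simp
  qed
  then have "108 * disc (h ?x) < (6 * n + ?w) ^ 3"
    using disc_le_cube(2)[OF _ F] n0 wt_nonneg[OF l] spread_nonneg[of ?x]
    unfolding wt_shift by simp
  also have "\<dots> \<le> (6 * (n + d + 1)) ^ 3"
    using w n0 wt_nonneg[OF l] by (intro power_mono) auto
  also have "\<dots> = 108 * (2 * (n + d + 1) ^ 3)" unfolding power_mult_distrib by simp
  finally show "disc (h ?x) < 2 * (n + d + 1) ^ 3" by simp
qed

section \<open>Short vectors of forms near a multiple of Q0\<close>

lemma shifted: "qscale n Q0 + h l = h (\<chi> i. n + l $ i)"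
  by (simp add: plus_qform_def qscale_def Q0_def h_def)

lemma act_shift: "act p (\<chi> i. n + l $ i) = (\<chi> i. n + act p l $ i)"
  by (simp add: act_def)

lemma eval_lower_bound:
  fixes x :: "'a :: linordered_idom ^ 3"
  assumes l: "\<And>i. l $ i \<ge> 0"
  shows "of_int (n - wt l) * qeval Q0 x \<le> qeval (h (\<chi> i. n + l $ i)) x"
  using h_lower_bound[OF l, of x] unfolding shifted[symmetric] qeval_plus qeval_qscale
  by (simp add: algebra_simps)

text \<open>A nonzero vector that is not a root satisfies \<open>Q\<^sub>0 \<ge> 2\<close>, so its value is at least
  \<open>2 (n - wt l)\<close>, which exceeds \<open>n + wt l\<close>.\<close>

lemma short_vector:
  fixes x :: "int ^ 3"
  assumes l: "\<And>i. l $ i \<ge> 0" and w: "3 * wt l < n" and x: "x \<noteq> 0"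
    and short: "qeval (h (\<chi> i. n + l $ i)) x \<le> n + wt l"
  shows "qeval Q0 x = 1"
proof (rule ccontr)
  assume "qeval Q0 x \<noteq> 1"
  then have "2 \<le> qeval Q0 x" using Q0_pos[OF x] by linarith
  then have "(n - wt l) * 2 \<le> (n - wt l) * qeval Q0 x"
    using w wt_nonneg[OF l] by (intro mult_left_mono) auto
  then show False using eval_lower_bound[OF l, of n x] w short by simp
qed

lemma value_at_root:
  assumes "qeval Q0 x = 1"
  obtains i where "\<And>l. qeval (h l) x = l $ i"
proof -
  obtain a b where ab: "a \<in> {1..4}" "b \<in> {1..4}" "a \<noteq> b" and x: "x = pt a - pt b"
    using Q0_eq_1[OF assms] .
  obtain i where i: "edge i = {a, b}" using ex_edge_pair[OF ab] .
  show thesis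
    by (rule that[of i]) (simp only: x qeval_h_root[OF i])
qed

text \<open>An equivalence sends each root to a vector of value at most \<open>n + wt m\<close>, hence to a root, and
  therefore comes from a permutation. The hypothesis \<open>wt l \<le> wt m\<close> can always be met by
  exchanging \<open>l\<close> and \<open>m\<close>.\<close>

lemma orbit_of_qequiv:
  assumes l: "\<And>i. l $ i \<ge> 0" and m: "\<And>i. m $ i \<ge> 0" and wm: "3 * wt m < n"
    and wl: "wt l \<le> wt m"
    and eq: "(h (\<chi> i. n + l $ i), h (\<chi> i. n + m $ i)) \<in> qequiv"
  obtains p where "p permutes {1..4}" "m = act p l"
proof -
  let ?x = "\<chi> i. n + l $ i" and ?y = "\<chi> i. n + m $ i"
  obtain U V :: "int ^ 3 ^ 3" where UV: "V ** U = mat 1"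
    and U: "\<And>x. qeval (h ?x) x = qeval (h ?y) (U *v x)"
    using eq by (auto simp: qequiv_def invertible_def)
  have "qeval Q0 (U *v minvec i) = 1" for i
  proof (rule short_vector[OF m wm])
    show "U *v minvec i \<noteq> 0"
      by (rule left_invertible_nonzero[OF UV minvec_nonzero])
    show "qeval (h ?y) (U *v minvec i) \<le> n + wt m"
      using le_wt[of l i, OF l] wl unfolding U[symmetric] qeval_h_minvec by simp
  qed
  then obtain p where p: "p permutes {1..4}"
    and act: "\<And>a b. a \<in> {1..4} \<Longrightarrow> b \<in> {1..4} \<Longrightarrow> U *v (pt a - pt b) = pt (p a) - pt (p b)
        \<or> U *v (pt a - pt b) = - (pt (p a) - pt (p b))"
    using isometry_permutes[of U] by blast
  have "m $ j = act p l $ j" for j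
  proof -
    obtain i where i: "p ` edge i = edge j" using ex_edge[OF p] by blast
    obtain a b where ab: "a \<in> {1..4}" "b \<in> {1..4}" "edge i = {a, b}" "minvec i = pt a - pt b"
      using minvec_edge by metis
    have "edge j = {p a, p b}" using i ab(3) by simp
    then have "?y $ j = qeval (h ?y) (pt (p a) - pt (p b))" by (rule qeval_h_root[symmetric])
    also have "\<dots> = qeval (h ?y) (U *v minvec i)"
      using act[OF ab(1,2)] unfolding ab(4) by (auto simp only: qeval_uminus)
    also have "\<dots> = ?x $ i" unfolding U[symmetric] qeval_h_minvec ..
    finally show ?thesis using act_nth[OF p i, of l] by simp
  qed
  then show thesis using that p by (simp add: vec_eq_iff)
qed

section \<open>The minimum\<close>

lemma qmin_eqI:
  fixes z :: "int ^ 3"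
  assumes "z \<noteq> 0" "qeval Q z = n" "\<And>x :: int ^ 3. x \<noteq> 0 \<Longrightarrow> n \<le> qeval Q x"
  shows "qmin Q = n"
  unfolding qmin_def using assms by (intro Least_equality) auto

lemma pos_def_int:
  fixes x :: "int ^ 3"
  assumes "pos_def Q" "x \<noteq> 0"
  shows "qeval Q x > 0"
proof -
  let ?x = "\<chi> i. real_of_int (x $ i)"
  have "?x \<noteq> 0" using assms(2) by (auto simp: vec_eq_iff)
  then have "qeval Q ?x > 0" using assms(1) by (simp add: pos_def_def)
  moreover have "qeval Q ?x = of_int (qeval Q x)" by (simp add: qeval_def)
  ultimately show ?thesis by simp
qed

lemma qmin_attained:
  assumes "pos_def Q"
  obtains z :: "int ^ 3" where "z \<noteq> 0" "qeval Q z = qmin Q"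
    "\<And>x :: int ^ 3. x \<noteq> 0 \<Longrightarrow> qmin Q \<le> qeval Q x"
proof -
  have "\<exists>z :: int ^ 3. z \<noteq> 0 \<and> (\<forall>x. x \<noteq> 0 \<longrightarrow> nat (qeval Q z) \<le> nat (qeval Q x))"
    by (rule ex_has_least_nat[where k = "minvec 1"]) (rule minvec_nonzero)
  then obtain z :: "int ^ 3" where z: "z \<noteq> 0"
    and least: "\<And>x. x \<noteq> 0 \<Longrightarrow> nat (qeval Q z) \<le> nat (qeval Q x)"
    by metis
  have le: "qeval Q z \<le> qeval Q x" if "x \<noteq> 0" for x :: "int ^ 3"
    using least[OF that] pos_def_int[OF assms that] by simp
  have "qmin Q = qeval Q z" by (rule qmin_eqI[OF z refl le])
  then show thesis using that[OF z] le by simp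
qed

section \<open>The bijection between orbits and classes\<close>

lemma lmin_eq_0:
  assumes "\<And>i. l $ i \<ge> 0"
  shows "lmin l = 0 \<longleftrightarrow> (\<exists>i. l $ i = 0)"
proof -
  have "lmin l \<in> range (\<lambda>i. l $ i)" unfolding lmin_def by (intro Min_in) auto
  then obtain j where j: "lmin l = l $ j" by blast
  have le: "lmin l \<le> l $ i" for i unfolding lmin_def by (intro Min_le) auto
  show ?thesis
  proof
    assume "lmin l = 0"
    then show "\<exists>i. l $ i = 0" using j by metis
  next
    assume "\<exists>i. l $ i = 0"
    then obtain i where "l $ i = 0" ..
    then show "lmin l = 0" using le[of i] assms[of j] j by simp
  qed
qed

lemma linear_bound:
  fixes n d :: int
  assumes "d \<ge> 0" "n \<ge> 3000 * (d + 1)\<^sup>2"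
  shows "18 * (d + 1) < n"
proof -
  define k where "k = d + 1"
  have "k \<ge> 1" "n \<ge> 3000 * k\<^sup>2" using assms by (auto simp: k_def)
  moreover from this have "k \<le> k\<^sup>2" by (simp add: power2_eq_square)
  ultimately show ?thesis unfolding k_def[symmetric] by linarith
qed

lemma form_in_Forms:
  assumes d: "d \<ge> 0" and n: "n \<ge> 3000 * (d + 1)\<^sup>2" and l: "l \<in> Lambda d"
  shows "h (\<chi> i. n + l $ i) \<in> Forms n d"
proof -
  let ?Q = "h (\<chi> i. n + l $ i)"
  have l0: "\<And>i. l $ i \<ge> 0" and w: "6 * d < wt l" "wt l \<le> 6 * (d + 1)"
    using l by (auto simp: Lambda_def)
  obtain i where i: "l $ i = 0" using l lmin_eq_0[of l] by (auto simp: Lambda_def)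
  have w3: "3 * wt l < n" using linear_bound[OF d n] w(2) by linarith
  have n0: "n - wt l > 0" using w3 wt_nonneg[OF l0] by linarith
  have "pos_def ?Q"
    unfolding pos_def_def
  proof (intro allI impI)
    fix x :: "real ^ 3" assume "x \<noteq> 0"
    then have "0 < of_int (n - wt l) * qeval Q0 x" using Q0_pos n0 by (intro mult_pos_pos) auto
    then show "0 < qeval ?Q x" using eval_lower_bound[OF l0, of n x] by linarith
  qed
  moreover have "qmin ?Q = n"
  proof (rule qmin_eqI)
    show "minvec i \<noteq> 0" by (rule minvec_nonzero)
    show "qeval ?Q (minvec i) = n" by (simp add: qeval_h_minvec i)
    fix x :: "int ^ 3" assume x: "x \<noteq> 0"
    show "n \<le> qeval ?Q x"
    proof (cases "qeval ?Q x \<le> n + wt l")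
      case True
      then have "qeval Q0 x = 1" by (rule short_vector[OF l0 w3 x])
      then obtain j where "\<And>l. qeval (h l) x = l $ j" using value_at_root by blast
      then show ?thesis using l0[of j] by simp
    next
      case False
      then show ?thesis using wt_nonneg[OF l0] by linarith
    qed
  qed
  ultimately show ?thesis
    using disc_bounds[OF l0 i d n w] by (simp add: Forms_def)
qed

text \<open>The Selling-reduced form in the class of \<open>Q\<close> is the representative. Its vector \<open>l\<close> has a zero entry
  because a vector where the minimum is attained is short, hence a root.\<close>

lemma Forms_representative:
  assumes d: "d \<ge> 0" and n: "n \<ge> 3000 * (d + 1)\<^sup>2" and Q: "Q \<in> Forms n d"
  obtains l where "l \<in> Lambda d" "(h (\<chi> i. n + l $ i), Q) \<in> qequiv"
proof -
  have pd: "pos_def Q" and min: "qmin Q = n"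
    and D: "2 * (n + d) ^ 3 < disc Q" "disc Q < 2 * (n + d + 1) ^ 3"
    using Q by (auto simp: Forms_def)
  obtain Q' where Q': "(Q', Q) \<in> qequiv" "disc Q' = disc Q" "\<And>i. selling Q' $ i \<ge> 0"
    using selling_reduction[OF pos_def_int[OF pd]] by blast
  obtain U V :: "int ^ 3 ^ 3" where UV: "U ** V = mat 1" "V ** U = mat 1"
    and U: "\<And>x. qeval Q' x = qeval Q (U *v x)"
    using Q'(1) by (auto simp: qequiv_def invertible_def)
  obtain z :: "int ^ 3" where z: "z \<noteq> 0" "qeval Q z = n"
    and least: "\<And>x :: int ^ 3. x \<noteq> 0 \<Longrightarrow> n \<le> qeval Q x"
    using qmin_attained[OF pd] unfolding min by blast
  have least': "n \<le> qeval Q' x" if "x \<noteq> 0" for x :: "int ^ 3"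
  proof -
    have "U *v x \<noteq> 0"
      by (rule left_invertible_nonzero[OF UV(2) that])
    then show ?thesis unfolding U by (rule least)
  qed
  have z': "V *v z \<noteq> 0" "qeval Q' (V *v z) = n"
    using left_invertible_nonzero[OF UV(1) z(1)] z(2) UV(1)
    by (simp_all add: U matrix_vector_mul_assoc)
  define l :: "int ^ 6" where "l = (\<chi> i. qeval Q' (minvec i) - n)"
  have l0: "l $ i \<ge> 0" for i using least'[OF minvec_nonzero] by (simp add: l_def)
  have Qh: "Q' = h (\<chi> i. n + l $ i)"
    using qform_eq_h[of Q'] by (simp add: l_def)
  have n18: "18 * (d + 1) < n" by (rule linear_bound[OF d n])
  have "0 < 2 * (n + d) ^ 3" using n18 d by simp
  then have "0 < disc Q'" using D Q'(2) by linarith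
  then have w: "wt l \<le> 6 * (d + 1)"
    using wt_le_of_reduced[of n l "d + 1"] Q'(2,3) l0 d n D unfolding Qh by (simp add: add.assoc)
  have "wt (selling Q') \<ge> 0" unfolding wt_def using Q'(3) by (intro sum_nonneg) auto
  then have w': "6 * d < wt l"
    using wt_gt_of_disc_gt[of n l d] l0 n18 d D(1) Q'(2) unfolding Qh by simp
  have "3 * wt l < n" using w n18 by linarith
  then have "qeval Q0 (V *v z) = 1"
    using z' wt_nonneg[OF l0] unfolding Qh by (intro short_vector[OF l0, of n]) auto
  then obtain i where "\<And>l. qeval (h l) (V *v z) = l $ i" using value_at_root by blast
  then have "l $ i = 0" using z'(2) unfolding Qh by simp
  then have "lmin l = 0" using lmin_eq_0[of l, OF l0] by blast
  then have "l \<in> Lambda d" using l0 w w' by (simp add: Lambda_def)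
  then show thesis using that Q'(1) Qh by simp
qed

theorem theorem3p7:
  fixes n d :: int
  assumes "d \<ge> 0" and "n \<ge> 3000 * (d + 1)\<^sup>2"
  shows "\<exists>\<Phi> :: (int ^ 6) set \<Rightarrow> qform set.
           (\<forall>l \<in> Lambda d. \<Phi> (orbit (sym_group 4) act l) = qequiv `` {qscale n Q0 + h l}) \<and>
           bij_betw \<Phi> (orbits (sym_group 4) (Lambda d) act) (Forms n d // qequiv)"
proof -
  let ?orb = "orbit (sym_group 4) act"
  define K where "K l = qequiv `` {h (\<chi> i. n + l $ i)}" for l
  define \<Phi> where "\<Phi> A = (\<Union>l\<in>A. K l)" for A
  interpret group_action "sym_group 4" UNIV act by (rule group_action_act)
  have orbit_iff: "m \<in> ?orb l \<longleftrightarrow> (\<exists>p. p permutes {1..4} \<and> m = act p l)" for l m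
    by (auto simp: orbit_def sym_group_def)
  have K_eq: "K l = K m \<longleftrightarrow> (h (\<chi> i. n + l $ i), h (\<chi> i. n + m $ i)) \<in> qequiv" for l m
    unfolding K_def by (simp add: eq_equiv_class_iff[OF equiv_qequiv])
  have K_act: "K l = K m" if "m \<in> ?orb l" for l m
    using that act_qequiv[of _ "\<chi> i. n + l $ i"] K_eq[of l m] unfolding orbit_iff by (auto simp: act_shift)
  have \<Phi>_orbit: "\<Phi> (?orb l) = K l" for l
  proof -
    have "\<Phi> (?orb l) = (\<Union>m\<in>?orb l. K l)"
      unfolding \<Phi>_def by (rule SUP_cong[OF refl]) (rule K_act[symmetric])
    then show ?thesis using orbit_refl[of l] by auto
  qed
  have orbit_eqI: "?orb l = ?orb m" if "m \<in> ?orb l" for l m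
    using that orbit_sym[of l m] orbit_trans[of l m] orbit_trans[of m l] by blast
  have inj: "?orb l = ?orb m" if lm: "l \<in> Lambda d" "m \<in> Lambda d" "wt l \<le> wt m" "K l = K m" for l m
  proof -
    have "3 * wt m < n" using linear_bound[OF assms] lm(2) by (auto simp: Lambda_def)
    then obtain p where "p permutes {1..4}" "m = act p l"
      using orbit_of_qequiv[of l m n] lm K_eq by (auto simp: Lambda_def)
    then show ?thesis using orbit_eqI orbit_iff by blast
  qed
  have "inj_on \<Phi> (orbits (sym_group 4) (Lambda d) act)"
  proof (rule inj_onI)
    fix A B
    assume AB: "A \<in> orbits (sym_group 4) (Lambda d) act" "B \<in> orbits (sym_group 4) (Lambda d) act"
      and "\<Phi> A = \<Phi> B"
    then obtain l m where lm: "l \<in> Lambda d" "m \<in> Lambda d" and A: "A = ?orb l" "B = ?orb m"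
      by (auto simp: orbits_def)
    have "K l = K m" using \<open>\<Phi> A = \<Phi> B\<close> unfolding A \<Phi>_orbit .
    then have "?orb l = ?orb m"
      using inj[OF lm] inj[OF lm(2,1)] by (cases "wt l \<le> wt m") simp_all
    then show "A = B" unfolding A .
  qed
  moreover have "\<Phi> ` orbits (sym_group 4) (Lambda d) act = Forms n d // qequiv"
  proof
    show "\<Phi> ` orbits (sym_group 4) (Lambda d) act \<subseteq> Forms n d // qequiv"
      using form_in_Forms[OF assms]
      by (auto simp: orbits_def \<Phi>_orbit K_def intro!: quotientI)
    show "Forms n d // qequiv \<subseteq> \<Phi> ` orbits (sym_group 4) (Lambda d) act"
    proof
      fix C assume "C \<in> Forms n d // qequiv"
      then obtain Q where Q: "Q \<in> Forms n d" "C = qequiv `` {Q}" by (auto elim: quotientE)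
      obtain l where l: "l \<in> Lambda d" "(h (\<chi> i. n + l $ i), Q) \<in> qequiv"
        using Forms_representative[OF assms Q(1)] .
      then have "C = \<Phi> (?orb l)"
        unfolding \<Phi>_orbit K_def Q(2) using equiv_class_eq[OF equiv_qequiv] by blast
      then show "C \<in> \<Phi> ` orbits (sym_group 4) (Lambda d) act"
        using l(1) by (auto simp: orbits_def)
    qed
  qed
  ultimately show ?thesis
    using \<Phi>_orbit unfolding K_def shifted by (intro exI[of _ \<Phi>]) (auto simp: bij_betw_def)
qed

end
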